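(* Let $\mathcal{B}$ be a real Banach space and let $\mathfrak{X}\subset\mathcal{B}$ be a nonempty set such that: (i) $\mathfrak{X}$ is a weakly compact subset of $\mathcal{B}$; (ii) for each $g\in\mathcal{C}_{pl}(\mathfrak{X},d_{\mathcal{B}})$, its linear extension $\tilde g$ to $\operatorname{span}(\mathfrak{X})$ is continuous on $\operatorname{span}(\mathfrak{X})$. Let $\delta,\sigma,\iota,\alpha:\ell^\infty(\mathfrak{X})\to\mathbb{R}$ be $\delta(f)=\|f\|_\infty$, $\sigma(f)=\sup_{\mathfrak{X}}f$, $\iota(f)=\inf_{\mathfrak{X}}f$, $\alpha(f)=\sup_{\mathfrak{X}}f-\inf_{\mathfrak{X}}f$. Then the maps $\sigma$, $\iota$ and $\alpha$ are Hadamard directionally differentiable at $f\in\ell^\infty(\mathfrak{X})$ tangentially to $\mathcal{C}_{pl}(\mathfrak{X},d_{\mathcal{B}})$ with derivatives, for $g\in\mathcal{C}_{pl}(\mathfrak{X},d_{\mathcal{B}})$, $$\sigma'_f(g)=\sup_{A^w_0(f)}g,\qquad \iota'_f(g)=\inf_{B^w_0(f)}g,\qquad \alpha'_f(g)=\sup_{A^w_0(f)}g-\inf_{B^w_0(f)}g.$$ If additionally $f\in\mathcal{C}_{pl}(\mathfrak{X},d_{\mathcal{B}})\setminus\{0\}$, then the derivatives of $\delta,\sigma,\iota,\alpha$ at $f$ (tangentially to $\mathcal{C}_{pl}(\mathfrak{X},d_{\mathcal{B}})$) are $$\delta'_f(g)=\sup_{M^+(|f|)}\big(g\cdot\operatorname{sgn}(f)\big),\quad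 \sigma'_f(g)=\sup_{M^+(f)}g,\quad \iota'_f(g)=\inf_{M^-(f)}g,\quad \alpha'_f(g)=\sup_{M^+(f)}g-\inf_{M^-(f)}g.$$
   Context: $\ell^\infty(\mathfrak{X})$ is the real Banach space of bounded functions $f:\mathfrak{X}\to\mathbb{R}$ with norm $\|f\|_\infty=\sup_{x\in\mathfrak{X}}|f(x)|$; $\operatorname{sgn}$ is the sign function. $d_{\mathcal{B}}$ is the metric induced by the norm of $\mathcal{B}$, and $x_n\rightharpoonup x$ denotes weak convergence in $\mathcal{B}$. A function $g:\mathfrak{X}\to\mathbb{R}$ is prelinear on $\mathfrak{X}$ if $\sum_{i=1}^r\lambda_ig(x_i)=0$ whenever $\sum_{i=1}^r\lambda_ix_i=0$, with $r<\infty$, $\lambda_i\in\mathbb{R}$, $x_i\in\mathfrak{X}$. Every prelinear $g$ has a unique linear extension $\tilde g$ to $\operatorname{span}(\mathfrak{X})$, given by $\tilde g(\sum_{i=1}^r\lambda_ix_i)=\sum_{i=1}^r\lambda_ig(x_i)$. $\mathcal{C}_{pl}(\mathfrak{X},d_{\mathcal{B}})$ is the set of bounded, ($d_{\mathcal{B}}$-)continuous, prelinear functions on $\mathfrak{X}$. For $h\in\ell^\infty(\mathfrak{X})$: $A^w_0(h)=\{x\in\mathfrak{X}:\exists\{x_n\}\subset\mathfrak{X},\ x_n\rightharpoonup x,\ h(x_n)\to\sup_{\mathfrak{X}}h\}$, $B^w_0(h)=\{x\in\mathfrak{X}:\exists\{x_n\}\subset\mathfrak{X},\ x_n\rightharpoonup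 x,\ h(x_n)\to\inf_{\mathfrak{X}}h\}$, $M^+(h)=\{x\in\mathfrak{X}:h(x)=\sup_{\mathfrak{X}}h\}$, $M^-(h)=\{x\in\mathfrak{X}:h(x)=\inf_{\mathfrak{X}}h\}$. Hadamard directional differentiability: let $\mathcal{D},\mathcal{E}$ be real Banach spaces. A map $\phi:\mathcal{D}\to\mathcal{E}$ is Hadamard directionally differentiable at $\theta\in\mathcal{D}$ tangentially to a set $\mathcal{D}_0\subset\mathcal{D}$ if there is a map $\phi'_\theta:\mathcal{D}_0\to\mathcal{E}$ (the derivative, not required to be linear) such that $\big\|\frac{\phi(\theta+t_nh_n)-\phi(\theta)}{t_n}-\phi'_\theta(h)\big\|_{\mathcal{E}}\to0$ for all $h\in\mathcal{D}_0$ and all sequences $\{t_n\}\subset\mathbb{R}$, $\{h_n\}\subset\mathcal{D}$ with $t_n\downarrow0$ and $\|h_n-h\|_{\mathcal{D}}\to0$. *)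

theory Defs
  imports "HOL-Analysis.Analysis" "HOL-Library.Function_Algebras"
begin

instantiation "fun" :: (type, real_vector) real_vector
begin

definition scaleR_fun :: "real \<Rightarrow> ('a \<Rightarrow> 'b) \<Rightarrow> 'a \<Rightarrow> 'b"
  where "scaleR_fun c f = (\<lambda>x. c *\<^sub>R f x)"

instance
  by standard (simp_all add: scaleR_fun_def fun_eq_iff scaleR_add_right scaleR_add_left)

end

text \<open>The real-valued functions on a subset of a type are represented by the functions on the
  whole type that vanish off the subset, so that the vector space operations (and the zero
  function) are the pointwise ones.\<close>

definition linfty :: "'a set \<Rightarrow> ('a \<Rightarrow> real) set"
  where "linfty X = {f. bounded (f ` X) \<and> (\<forall>x. x \<notin> X \<longrightarrow> f x = 0)}"

definition linfty_norm :: "'a set \<Rightarrow> ('a \<Rightarrow> real) \<Rightarrow> real"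
  where "linfty_norm X f = (SUP x\<in>X. \<bar>f x\<bar>)"

lemma subspace_linfty: "subspace (linfty X)"
proof (rule subspaceI)
  show "0 \<in> linfty X"
    by (auto simp: linfty_def bounded_iff)
next
  fix f g assume "f \<in> linfty X" "g \<in> linfty X"
  then show "f + g \<in> linfty X"
    using bounded_plus_comp[of f X g] by (auto simp: linfty_def)
next
  fix c and f :: "'a \<Rightarrow> real" assume "f \<in> linfty X"
  then show "c *\<^sub>R f \<in> linfty X"
    using bounded_scaleR_comp[of f X c] by (auto simp: linfty_def scaleR_fun_def)
qed

definition weak_topology :: "'b::real_normed_vector topology"
  where "weak_topology =
    topology_generated_by {\<phi> -` U | (\<phi> :: 'b \<Rightarrow> real) U. bounded_linear \<phi> \<and> open U}"

definition prelinear :: "'b::real_vector set \<Rightarrow> ('b \<Rightarrow> real) \<Rightarrow> bool"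
  where "prelinear X g \<longleftrightarrow>
    (\<forall>(r::nat) (c :: nat \<Rightarrow> real) (x :: nat \<Rightarrow> 'b).
       (\<forall>i\<in>{1..r}. x i \<in> X) \<and> (\<Sum>i=1..r. c i *\<^sub>R x i) = 0
         \<longrightarrow> (\<Sum>i=1..r. c i * g (x i)) = 0)"

text \<open>Meaningful for prelinear functions and on the span only; see \<open>lin_ext_sum\<close>.\<close>

definition lin_ext :: "'b::real_vector set \<Rightarrow> ('b \<Rightarrow> real) \<Rightarrow> 'b \<Rightarrow> real"
  where "lin_ext X g v =
    (THE s. \<exists>(r::nat) (c :: nat \<Rightarrow> real) (x :: nat \<Rightarrow> 'b).
       (\<forall>i\<in>{1..r}. x i \<in> X) \<and> v = (\<Sum>i=1..r. c i *\<^sub>R x i) \<and> s = (\<Sum>i=1..r. c i * g (x i)))"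

lemma prelinear_sum_unique:
  fixes x y :: "nat \<Rightarrow> 'b::real_vector"
  assumes g: "prelinear X g"
    and x: "\<forall>i\<in>{1..r}. x i \<in> X" and y: "\<forall>i\<in>{1..s}. y i \<in> X"
    and eq: "(\<Sum>i=1..r. c i *\<^sub>R x i) = (\<Sum>i=1..s. d i *\<^sub>R y i)"
  shows "(\<Sum>i=1..r. c i * g (x i)) = (\<Sum>i=1..s. d i * g (y i))"
proof -
  define e where "e i = (if i \<le> r then c i else - d (i - r))" for i
  define z where "z i = (if i \<le> r then x i else y (i - r))" for i
  have split: "(\<Sum>i=1..r+s. F (e i) (z i)) = (\<Sum>i=1..r. F (c i) (x i)) + (\<Sum>i=1..s. F (- d i) (y i))"
    for F :: "real \<Rightarrow> 'b \<Rightarrow> 'c::comm_monoid_add"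
  proof -
    have "(\<Sum>i=1..r+s. F (e i) (z i))
        = (\<Sum>i=1..r. F (e i) (z i)) + (\<Sum>i=r+1..r+s. F (e i) (z i))"
      by (rule sum.ub_add_nat) simp
    also have "(\<Sum>i=r+1..r+s. F (e i) (z i)) = (\<Sum>i=1..s. F (e (i + r)) (z (i + r)))"
      using sum.shift_bounds_cl_nat_ivl[of "\<lambda>i. F (e i) (z i)" 1 r s] by (simp add: add.commute)
    finally show ?thesis
      by (simp add: e_def z_def)
  qed
  have "\<forall>i\<in>{1..r+s}. z i \<in> X"
  proof
    fix i assume "i \<in> {1..r+s}"
    moreover from this have "i - r \<in> {1..s}" if "\<not> i \<le> r"
      using that by auto
    ultimately show "z i \<in> X"
      using x y by (auto simp: z_def)
  qed
  moreover have "(\<Sum>i=1..r+s. e i *\<^sub>R z i) = 0"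
    using eq split[of "\<lambda>a b. a *\<^sub>R b"] by (simp add: sum_negf)
  ultimately have "(\<Sum>i=1..r+s. e i * g (z i)) = 0"
    using g unfolding prelinear_def by blast
  then show ?thesis
    using split[of "\<lambda>a b. a * g b"] by (simp add: sum_negf)
qed

lemma lin_ext_sum:
  fixes x :: "nat \<Rightarrow> 'b::real_vector"
  assumes "prelinear X g" and "\<forall>i\<in>{1..r}. x i \<in> X"
  shows "lin_ext X g (\<Sum>i=1..r. c i *\<^sub>R x i) = (\<Sum>i=1..r. c i * g (x i))"
  unfolding lin_ext_def
proof (rule the_equality)
  show "\<exists>(r'::nat) (c' :: nat \<Rightarrow> real) (x' :: nat \<Rightarrow> 'b). (\<forall>i\<in>{1..r'}. x' i \<in> X) \<and>
      (\<Sum>i=1..r. c i *\<^sub>R x i) = (\<Sum>i=1..r'. c' i *\<^sub>R x' i) \<and>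
      (\<Sum>i=1..r. c i * g (x i)) = (\<Sum>i=1..r'. c' i * g (x' i))"
    using assms(2) by (intro exI[of _ r] exI[of _ c] exI[of _ x]) simp
next
  fix s
  assume "\<exists>(r'::nat) (c' :: nat \<Rightarrow> real) (x' :: nat \<Rightarrow> 'b). (\<forall>i\<in>{1..r'}. x' i \<in> X) \<and>
      (\<Sum>i=1..r. c i *\<^sub>R x i) = (\<Sum>i=1..r'. c' i *\<^sub>R x' i) \<and>
      s = (\<Sum>i=1..r'. c' i * g (x' i))"
  then obtain r' :: nat and c' and x' :: "nat \<Rightarrow> 'b" where *: "\<forall>i\<in>{1..r'}. x' i \<in> X"
      "(\<Sum>i=1..r. c i *\<^sub>R x i) = (\<Sum>i=1..r'. c' i *\<^sub>R x' i)"
    and s: "s = (\<Sum>i=1..r'. c' i * g (x' i))"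
    by (elim exE conjE)
  show "s = (\<Sum>i=1..r. c i * g (x i))"
    unfolding s by (rule prelinear_sum_unique[OF assms *, symmetric])
qed

definition C_pl :: "'b::real_normed_vector set \<Rightarrow> ('b \<Rightarrow> real) set"
  where "C_pl X = {g \<in> linfty X. continuous_on X g \<and> prelinear X g}"

definition A0w :: "'b::real_normed_vector set \<Rightarrow> ('b \<Rightarrow> real) \<Rightarrow> 'b set"
  where "A0w X h = {x\<in>X. \<exists>xs. (\<forall>n. xs n \<in> X) \<and> limitin weak_topology xs x sequentially \<and>
                               (\<lambda>n. h (xs n)) \<longlonglongrightarrow> (SUP y\<in>X. h y)}"

definition B0w :: "'b::real_normed_vector set \<Rightarrow> ('b \<Rightarrow> real) \<Rightarrow> 'b set"
  where "B0w X h = {x\<in>X. \<exists>xs. (\<forall>n. xs n \<in> X) \<and> limitin weak_topology xs x sequentially \<and>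
                               (\<lambda>n. h (xs n)) \<longlonglongrightarrow> (INF y\<in>X. h y)}"

definition M_plus :: "'a set \<Rightarrow> ('a \<Rightarrow> real) \<Rightarrow> 'a set"
  where "M_plus X h = {x\<in>X. h x = (SUP y\<in>X. h y)}"

definition M_minus :: "'a set \<Rightarrow> ('a \<Rightarrow> real) \<Rightarrow> 'a set"
  where "M_minus X h = {x\<in>X. h x = (INF y\<in>X. h y)}"

text \<open>The domain is a normed space given by a linear subspace \<open>D\<close> (of an arbitrary real vector
  space) with norm \<open>nrm\<close>, because \<^term>\<open>linfty X\<close> depends on the set \<open>X\<close> and
  so is not a type.  The map \<open>\<phi>\<close> has derivative \<open>\<phi>'\<close> at \<open>\<theta> \<in> D\<close> tangentially to
  \<open>D\<^sub>0 \<subseteq> D\<close>; only the values of \<open>\<phi>\<close> on \<open>D\<close> and of \<open>\<phi>'\<close> on \<open>D\<^sub>0\<close> matter.\<close>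

definition has_hadamard_dir_derivative ::
  "'d::real_vector set \<Rightarrow> ('d \<Rightarrow> real) \<Rightarrow> ('d \<Rightarrow> 'e::banach) \<Rightarrow> ('d \<Rightarrow> 'e) \<Rightarrow> 'd \<Rightarrow> 'd set \<Rightarrow> bool"
  where "has_hadamard_dir_derivative D nrm \<phi> \<phi>' \<theta> D\<^sub>0 \<longleftrightarrow>
    \<theta> \<in> D \<and> D\<^sub>0 \<subseteq> D \<and>
    (\<forall>h\<in>D\<^sub>0. \<forall>(t :: nat \<Rightarrow> real) (hs :: nat \<Rightarrow> 'd).
       (\<forall>n. 0 < t n) \<and> t \<longlonglongrightarrow> 0 \<and> (\<forall>n. hs n \<in> D) \<and> (\<lambda>n. nrm (hs n - h)) \<longlonglongrightarrow> 0
         \<longrightarrow> (\<lambda>n. norm ((\<phi> (\<theta> + t n *\<^sub>R hs n) - \<phi> \<theta>) /\<^sub>R t n - \<phi>' h)) \<longlonglongrightarrow> 0)"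

end

theory Submission
  imports Defs "HOL-Complex_Analysis.Great_Picard"
begin

text \<open>By (ii) and the Hahn-Banach theorem every \<open>g \<in> C_pl X\<close> is the restriction of a bounded linear
  functional and is therefore weakly sequentially continuous on \<open>X\<close>; by the Eberlein-Smulian theorem
  every sequence in \<open>X\<close> has a subsequence converging weakly in \<open>X\<close>. The derivative of the supremum at
  \<open>f\<close> in direction \<open>g\<close> is the largest limit of \<open>g\<close> along sequences maximizing \<open>f\<close>, and these limits are
  exactly the values of \<open>g\<close> on \<open>A0w X f\<close>. If \<open>f\<close> is itself in \<open>C_pl X\<close>, the weak limits of maximizing
  sequences are exactly the maximizers.\<close>

subsection \<open>The Hahn-Banach theorem\<close>

text \<open>The constant \<open>c\<close> is the value given to \<open>u\<close>. It has to lie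
  above every \<open>a - K * norm (v - u)\<close> and below every
  \<open>K * norm (w + u) - b\<close>; by the triangle inequality all the former are below all the
  latter, so the supremum of the former serves.\<close>

lemma hahn_banach_graph_step:
  fixes G :: "('b::real_normed_vector \<times> real) set"
  assumes G: "subspace G" and le: "\<And>v a. (v, a) \<in> G \<Longrightarrow> a \<le> K * norm v" and K: "0 \<le> K"
  obtains c where "\<And>v a. (v, a) \<in> span (insert (u, c) G) \<Longrightarrow> a \<le> K * norm v"
proof -
  have sep: "a - K * norm (v - u) \<le> K * norm (w + u) - b" if "(v, a) \<in> G" "(w, b) \<in> G" for v a w b
  proof -
    have "a + b \<le> K * norm (v + w)"
      using le[of "v + w" "a + b"] subspace_add[OF G that] by simp
    also have "\<dots> \<le> K * (norm (v - u) + norm (w + u))"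
      using norm_triangle_ineq[of "v - u" "w + u"] K by (intro mult_left_mono) auto
    finally show ?thesis by (simp add: algebra_simps)
  qed
  define L where "L = (\<lambda>(v, a). a - K * norm (v - u)) ` G"
  define c where "c = Sup L"
  \<comment> \<open>The origin makes \<open>L\<close> nonempty and, through \<open>sep\<close>,
    bounded above.\<close>
  have 0: "(0, 0) \<in> G"
    using subspace_0[OF G] by (simp add: zero_prod_def)
  have lower: "a - K * norm (v - u) \<le> c" if "(v, a) \<in> G" for v a
    unfolding c_def
  proof (rule cSup_upper)
    show "bdd_above L"
      using sep[OF _ 0] by (auto simp: L_def intro!: bdd_aboveI)
  qed (use that in \<open>force simp: L_def\<close>)
  have upper: "c \<le> K * norm (w + u) - b" if "(w, b) \<in> G" for w b
    unfolding c_def by (rule cSup_least) (use 0 sep[OF _ that] in \<open>auto simp: L_def\<close>)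
  show thesis
  proof (rule that)
    fix v a assume "(v, a) \<in> span (insert (u, c) G)"
    then obtain k where k: "(v - k *\<^sub>R u, a - k * c) \<in> G"
      using span_eq_iff[THEN iffD2, OF G] by (auto simp: span_insert)
    \<comment> \<open>After division by the modulus of \<open>k\<close>, a positive \<open>k\<close>
      calls for the upper bound on \<open>c\<close> and a negative one for the lower bound; in both
      cases \<open>c\<close> cancels.\<close>
    consider "k = 0" | "k > 0" | "k < 0" by linarith
    then show "a \<le> K * norm v"
    proof cases
      case 1 then show ?thesis using k le by simp
    next
      case 2
      have "(v /\<^sub>R k - u, a / k - c) \<in> G"
        using subspace_scale[OF G k, of "1 / k"] 2
        by (simp add: scaleR_diff_right diff_divide_distrib inverse_eq_divide)
      from upper[OF this] have "a / k \<le> K * norm v / k"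
        using 2 by (simp add: divide_inverse mult.assoc mult.commute)
      then show ?thesis using 2 by (simp add: divide_le_cancel)
    next
      case 3
      define m where "m = - k"
      have m: "m > 0" using 3 by (simp add: m_def)
      have "(v /\<^sub>R m + u, a / m + c) \<in> G"
        using subspace_scale[OF G k, of "1 / m"] m
        by (simp add: scaleR_diff_right scaleR_add_right diff_divide_distrib add_divide_distrib inverse_eq_divide m_def)
      from lower[OF this] have "a / m \<le> K * norm v / m"
        using m by (simp add: divide_inverse mult.assoc mult.commute)
      then show ?thesis using m by (simp add: divide_le_cancel)
    qed
  qed
qed

text \<open>A linear functional on a subspace, bounded by \<open>K * norm\<close>, is represented by its graph, a subspace
  of the product with the reals on which \<open>a \<le> K * norm v\<close>. Single-valuedness is automatic:
  \<open>(0, a)\<close> and \<open>(0, - a)\<close> in the graph force \<open>a = 0\<close>. So Zorn's lemma applies to plain subspaces.\<close>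

lemma hahn_banach_graph:
  fixes G :: "('b::real_normed_vector \<times> real) set"
  assumes G: "subspace G" and le: "\<And>v a. (v, a) \<in> G \<Longrightarrow> a \<le> K * norm v" and K: "0 \<le> K"
  obtains \<phi> :: "'b \<Rightarrow> real" where "bounded_linear \<phi>" "\<And>v a. (v, a) \<in> G \<Longrightarrow> \<phi> v = a" "\<And>v. \<phi> v \<le> K * norm v"
proof -
  define \<A> where "\<A> = {H. subspace H \<and> G \<subseteq> H \<and> (\<forall>(v, a)\<in>H. a \<le> K * norm v)}"
  have "\<exists>M\<in>\<A>. \<forall>H\<in>\<A>. M \<subseteq> H \<longrightarrow> H = M"
  proof (rule subset_Zorn_nonempty)
    show "\<A> \<noteq> {}" using G le by (auto simp: \<A>_def)
  next
    fix C assume C: "C \<noteq> {}" "subset.chain \<A> C"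
    have sub: "H \<in> \<A>" if "H \<in> C" for H
      using C that by (auto simp: subset.chain_def)
    have tot: "H \<subseteq> H' \<or> H' \<subseteq> H" if "H \<in> C" "H' \<in> C" for H H'
      using C that by (auto simp: subset.chain_def)
    have "subspace (\<Union>C)"
    proof (rule subspaceI)
      show "0 \<in> \<Union>C" using C(1) sub unfolding \<A>_def by (blast dest: subspace_0)
    next
      fix x y assume "x \<in> \<Union>C" "y \<in> \<Union>C"
      then obtain H where H: "H \<in> C" "x \<in> H" "y \<in> H" using tot by blast
      then have "x + y \<in> H" using sub[OF H(1)] by (auto simp: \<A>_def intro: subspace_add)
      then show "x + y \<in> \<Union>C" using H by blast
    next
      fix c x assume "x \<in> \<Union>C"
      then obtain H where H: "H \<in> C" "x \<in> H" by blast
      then have "c *\<^sub>R x \<in> H" using sub[OF H(1)] by (auto simp: \<A>_def intro: subspace_scale)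
      then show "c *\<^sub>R x \<in> \<Union>C" using H by blast
    qed
    moreover have "G \<subseteq> \<Union>C" using C(1) sub unfolding \<A>_def by blast
    moreover have "\<forall>(v, a)\<in>\<Union>C. a \<le> K * norm v" using sub unfolding \<A>_def by blast
    ultimately show "\<Union>C \<in> \<A>" by (simp add: \<A>_def)
  qed
  then obtain M where "M \<in> \<A>" and max: "\<And>H. H \<in> \<A> \<Longrightarrow> M \<subseteq> H \<Longrightarrow> H = M"
    by blast
  then have M: "subspace M" "G \<subseteq> M" and leM: "\<And>v a. (v, a) \<in> M \<Longrightarrow> a \<le> K * norm v"
    by (auto simp: \<A>_def)
  \<comment> \<open>One more extension step at \<open>u\<close> yields a member of
    \<open>\<A>\<close> above \<open>M\<close>, so by maximality it adds nothing.\<close>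
  have total: "\<exists>a. (u, a) \<in> M" for u
  proof -
    obtain c where c: "\<And>v a. (v, a) \<in> span (insert (u, c) M) \<Longrightarrow> a \<le> K * norm v"
      using hahn_banach_graph_step[OF M(1) leM K] by blast
    have sup: "insert (u, c) M \<subseteq> span (insert (u, c) M)" by (rule span_superset)
    then have "span (insert (u, c) M) \<in> \<A>" using M(2) c by (auto simp: \<A>_def)
    then show ?thesis using max sup by blast
  qed
  have unique: "a = b" if "(v, a) \<in> M" "(v, b) \<in> M" for v a b
    using leM[of 0 "a - b"] leM[of 0 "b - a"] subspace_diff[OF M(1) that]
      subspace_diff[OF M(1) that(2,1)] by simp
  define \<phi> where "\<phi> v = (THE a. (v, a) \<in> M)" for v
  have \<phi>: "(v, \<phi> v) \<in> M" for v
    unfolding \<phi>_def by (rule theI') (use total unique in blast)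
  have eq: "\<phi> v = a" if "(v, a) \<in> M" for v a
    using unique[OF \<phi> that] .
  have bd: "\<phi> v \<le> K * norm v" for v using leM \<phi> by blast
  have sc: "\<phi> (c *\<^sub>R v) = c * \<phi> v" for c v
    using subspace_scale[OF M(1) \<phi>[of v], of c] by (auto intro: eq)
  have "bounded_linear \<phi>"
  proof (rule bounded_linear_intro)
    show "\<phi> (v + w) = \<phi> v + \<phi> w" for v w
      using subspace_add[OF M(1) \<phi>[of v] \<phi>[of w]] by (auto intro: eq)
    show "\<phi> (c *\<^sub>R v) = c *\<^sub>R \<phi> v" for c v by (simp add: sc)
    \<comment> \<open>The one-sided bound at \<open>v\<close> and at \<open>- v\<close> gives the
      two-sided one.\<close>
    show "norm (\<phi> v) \<le> norm v * K" for v
      using bd[of v] bd[of "- v"] sc[of "-1" v] by (simp add: mult.commute abs_le_iff)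
  qed
  then show thesis using that eq M(2) bd by blast
qed

text \<open>Sending \<open>k *\<^sub>R x + y\<close> with \<open>y\<close> in \<open>S\<close> to
  \<open>k * d\<close> is dominated by the norm because \<open>x\<close> stays at distance at least
  \<open>d\<close> from \<open>S\<close>; Hahn-Banach extends this functional. The choice
  \<open>S = {0}\<close>, \<open>d = norm x\<close> gives a norming functional of
  \<open>x\<close>.\<close>

lemma separating_functional:
  fixes S :: "'b::real_normed_vector set"
  assumes S: "subspace S" and d: "\<And>y. y \<in> S \<Longrightarrow> d \<le> norm (x - y)" "0 \<le> d"
  obtains \<phi> :: "'b \<Rightarrow> real" where "bounded_linear \<phi>" "\<And>y. y \<in> S \<Longrightarrow> \<phi> y = 0" "\<phi> x = d"
    "\<And>v. \<phi> v \<le> norm v"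
proof -
  have sub: "subspace (S \<times> {0::real})"
    using S by (intro subspaceI) (auto simp: subspace_add subspace_scale zero_prod_def subspace_0)
  have le: "a \<le> 1 * norm v" if "(v, a) \<in> span (insert (x, d) (S \<times> {0}))" for v a
  proof -
    from that obtain k where k: "v - k *\<^sub>R x \<in> S" "a = k * d"
      using span_eq_iff[THEN iffD2, OF sub] by (auto simp: span_insert)
    show ?thesis
    proof (cases "k \<le> 0")
      case True
      then have "k * d \<le> 0" using d(2) by (simp add: mult_le_0_iff)
      then show ?thesis using k(2) norm_ge_zero[of v] by linarith
    next
      case False
      \<comment> \<open>Subtracting this element of \<open>S\<close> from \<open>x\<close> leaves
        \<open>v\<close> divided by \<open>k\<close>, whose norm is therefore at least
        \<open>d\<close>.\<close>
      have "- (1 / k) *\<^sub>R (v - k *\<^sub>R x) \<in> S" using subspace_scale[OF S k(1)] .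
      then have "d \<le> norm (x + (1 / k) *\<^sub>R (v - k *\<^sub>R x))" using d(1) by fastforce
      also have "x + (1 / k) *\<^sub>R (v - k *\<^sub>R x) = (1 / k) *\<^sub>R v"
        using False by (simp add: scaleR_diff_right)
      finally show ?thesis using False k(2) by (simp add: field_simps)
    qed
  qed
  obtain \<phi> :: "'b \<Rightarrow> real" where \<phi>: "bounded_linear \<phi>"
      "\<And>v a. (v, a) \<in> span (insert (x, d) (S \<times> {0})) \<Longrightarrow> \<phi> v = a" "\<And>v. \<phi> v \<le> 1 * norm v"
    using hahn_banach_graph[OF subspace_span le] by auto
  have "\<phi> y = 0" if "y \<in> S" for y using that by (intro \<phi>(2) span_base) auto
  moreover have "\<phi> x = d" by (intro \<phi>(2) span_base) auto
  ultimately show thesis using \<phi> that by simp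
qed

subsection \<open>Weak compactness and weak sequential compactness\<close>

lemma openin_weak_topology_vimage:
  fixes \<phi> :: "'b::real_normed_vector \<Rightarrow> real"
  assumes "bounded_linear \<phi>" "open U"
  shows "openin weak_topology (\<phi> -` U)"
  unfolding weak_topology_def by (rule topology_generated_by_Basis) (use assms in blast)

lemma topspace_weak_topology [simp]: "topspace weak_topology = UNIV"
  using openin_subset[OF openin_weak_topology_vimage[OF bounded_linear_zero open_UNIV]] by auto

lemma limitin_weak_topology_imp_tendsto:
  fixes \<phi> :: "'b::real_normed_vector \<Rightarrow> real"
  assumes "limitin weak_topology xs x F" "bounded_linear \<phi>"
  shows "((\<lambda>n. \<phi> (xs n)) \<longlongrightarrow> \<phi> x) F"
  unfolding tendsto_def
proof (intro allI impI)
  fix U assume "open U" "\<phi> x \<in> U"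
  then have "\<forall>\<^sub>F n in F. xs n \<in> \<phi> -` U"
    using assms(1) openin_weak_topology_vimage[OF assms(2)] unfolding limitin_def by blast
  then show "\<forall>\<^sub>F n in F. \<phi> (xs n) \<in> U" by simp
qed

lemma weakly_compact_bounded_image:
  fixes \<phi> :: "'b::real_normed_vector \<Rightarrow> real"
  assumes "compactin weak_topology X" "bounded_linear \<phi>"
  shows "bounded (\<phi> ` X)"
proof -
  have "continuous_map weak_topology euclidean \<phi>"
    using openin_weak_topology_vimage[OF assms(2)] by (auto simp: continuous_map_def vimage_def)
  then have "compactin euclidean (\<phi> ` X)" using assms(1) by (rule image_compactin[rotated])
  then show ?thesis by (simp add: compact_imp_bounded)
qed

text \<open>Otherwise each point of \<open>K\<close> has an open neighbourhood that \<open>y\<close>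
  eventually avoids. Finitely many of them cover \<open>K\<close>, so \<open>y\<close> would
  eventually avoid \<open>K\<close>.\<close>

lemma compactin_cluster_point:
  assumes K: "compactin T K" and ys: "\<exists>\<^sub>F j in F. y j \<in> K"
  obtains x where "x \<in> K" "\<And>U. openin T U \<Longrightarrow> x \<in> U \<Longrightarrow> \<exists>\<^sub>F j in F. y j \<in> U"
proof (rule ccontr)
  assume "\<not> thesis"
  then have ex: "\<forall>x\<in>K. \<exists>U. openin T U \<and> x \<in> U \<and> (\<forall>\<^sub>F j in F. y j \<notin> U)"
    using that by (auto simp: frequently_def)
  define N where "N = {U. openin T U \<and> (\<forall>\<^sub>F j in F. y j \<notin> U)}"
  have "K \<subseteq> \<Union>N" "\<forall>U\<in>N. openin T U" using ex by (auto simp: N_def)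
  then obtain C where C: "finite C" "C \<subseteq> N" "K \<subseteq> \<Union>C"
    using K unfolding compactin_def by meson
  then have "\<forall>\<^sub>F j in F. \<forall>U\<in>C. y j \<notin> U" by (subst eventually_ball_finite_distrib) (auto simp: N_def)
  then have "\<forall>\<^sub>F j in F. y j \<notin> K" by eventually_elim (use C in blast)
  then show False using ys by (simp add: frequently_def)
qed

section \<open>Closed spans and countable separating families\<close>

lemma subspace_closure:
  fixes S :: "'b::real_normed_vector set"
  assumes "subspace S"
  shows "subspace (closure S)"
proof (rule subspaceI)
  show "0 \<in> closure S" using subspace_0[OF assms] closure_subset by blast
next
  fix u v assume "u \<in> closure S" "v \<in> closure S"
  then obtain a b where ab: "\<And>n. a n \<in> S" "a \<longlonglongrightarrow> u" "\<And>n. b n \<in> S" "b \<longlonglongrightarrow> v"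
    unfolding closure_sequential by blast
  show "u + v \<in> closure S"
    unfolding closure_sequential
    by (rule exI[of _ "\<lambda>n. a n + b n"]) (use ab in \<open>auto intro: subspace_add[OF assms] tendsto_add\<close>)
next
  fix r :: real and v assume "v \<in> closure S"
  then obtain b where b: "\<And>n. b n \<in> S" "b \<longlonglongrightarrow> v"
    unfolding closure_sequential by blast
  show "r *\<^sub>R v \<in> closure S"
    unfolding closure_sequential
    by (rule exI[of _ "\<lambda>n. r *\<^sub>R b n"]) (use b in \<open>auto intro: subspace_scale[OF assms] tendsto_intros\<close>)
qed

text \<open>The finite combinations with rational coefficients form a countable set, and its closure
  is a real subspace containing the sequence.\<close>

lemma countable_dense_in_span:
  fixes x :: "nat \<Rightarrow> 'b::real_normed_vector"
  obtains D where "countable D" "span (range x) \<subseteq> closure D"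
proof -
  have lim: "l \<in> closure C" if "\<And>n. w n \<in> C" "w \<longlonglongrightarrow> l" for w l and C :: "'b set"
    using that unfolding closure_sequential by blast
  \<comment> \<open>Coding combinations by lists of coefficient-index pairs makes countability
    immediate and turns addition into concatenation.\<close>
  define c where "c qs = (\<Sum>(q, i)\<leftarrow>qs. of_rat q *\<^sub>R x i)" for qs :: "(rat \<times> nat) list"
  have add: "c qs + c qs' = c (qs @ qs')" for qs qs' by (simp add: c_def)
  have scale: "of_rat q *\<^sub>R c qs = c (map (\<lambda>(q', i). (q * q', i)) qs)" for q qs
    by (induction qs) (auto simp: c_def scaleR_add_right of_rat_mult)
  have "span (range x) \<subseteq> closure (range c)"
  proof (rule span_minimal)
    have "x i = c [(1, i)]" for i by (simp add: c_def)
    then have "range x \<subseteq> range c" by auto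
    then show "range x \<subseteq> closure (range c)" using closure_subset by blast
  next
    show "subspace (closure (range c))"
    proof (rule subspaceI)
      have "c [] = 0" by (simp add: c_def)
      then show "0 \<in> closure (range c)" using closure_subset[of "range c"] by (metis rangeI subsetD)
    next
      fix u v assume "u \<in> closure (range c)" "v \<in> closure (range c)"
      then obtain a b where ab: "\<And>n. a n \<in> range c" "a \<longlonglongrightarrow> u" "\<And>n. b n \<in> range c" "b \<longlonglongrightarrow> v"
        unfolding closure_sequential by blast
      have "a n + b n \<in> range c" for n
      proof -
        obtain qs qs' where "a n = c qs" "b n = c qs'" using ab(1,3)[of n] by (elim rangeE)
        then show ?thesis by (simp add: add)
      qed
      then show "u + v \<in> closure (range c)" by (rule lim[OF _ tendsto_add[OF ab(2,4)]])
    next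
      fix r :: real and v assume "v \<in> closure (range c)"
      then obtain b where b: "\<And>n. b n \<in> range c" "b \<longlonglongrightarrow> v"
        unfolding closure_sequential by blast
      \<comment> \<open>Since \<open>scale\<close> covers rational factors only, \<open>r\<close> is
        approximated by rationals.\<close>
      have "r \<in> closure \<rat>" by (simp add: Rats_closure_real)
      then obtain p :: "nat \<Rightarrow> real" where p: "\<And>n. p n \<in> \<rat>" "p \<longlonglongrightarrow> r"
        unfolding closure_sequential by blast
      have "p n *\<^sub>R b n \<in> range c" for n
      proof -
        obtain q qs where "p n = of_rat q" "b n = c qs" using b(1)[of n] p(1)[of n] by (elim rangeE Rats_cases)
        then show ?thesis by (simp add: scale)
      qed
      then show "r *\<^sub>R v \<in> closure (range c)" by (rule lim[OF _ tendsto_scaleR[OF p(2) b(2)]])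
    qed
  qed
  then show thesis using that[of "range c"] by simp
qed

text \<open>The family consists of norming functionals of the points of a countable set
  \<open>D\<close> whose closure contains the span. If all of them vanish at \<open>y\<close>, then
  the points of \<open>D\<close> near \<open>y\<close> have small norm, and so has
  \<open>y\<close>.\<close>

lemma countable_separating_family:
  fixes x :: "nat \<Rightarrow> 'b::real_normed_vector"
  obtains \<Phi> :: "('b \<Rightarrow> real) set" where "countable \<Phi>" "\<And>\<phi>. \<phi> \<in> \<Phi> \<Longrightarrow> bounded_linear \<phi>"
    "\<And>y. y \<in> closure (span (range x)) \<Longrightarrow> (\<And>\<phi>. \<phi> \<in> \<Phi> \<Longrightarrow> \<phi> y = 0) \<Longrightarrow> y = 0"
proof -
  obtain D where D: "countable D" "span (range x) \<subseteq> closure D"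
    by (rule countable_dense_in_span)
  have "\<exists>\<phi> :: 'b \<Rightarrow> real. bounded_linear \<phi> \<and> \<phi> d = norm d \<and> (\<forall>v. \<phi> v \<le> norm v)" for d
  proof -
    obtain \<phi> :: "'b \<Rightarrow> real" where "bounded_linear \<phi>" "\<phi> d = norm d" "\<And>v. \<phi> v \<le> norm v"
      by (rule separating_functional[of "{0}" "norm d" d]) (auto simp: subspace_single_0)
    then show ?thesis by blast
  qed
  then obtain \<phi> :: "'b \<Rightarrow> 'b \<Rightarrow> real" where \<phi>: "\<And>d. bounded_linear (\<phi> d)" "\<And>d. \<phi> d d = norm d"
      "\<And>d v. \<phi> d v \<le> norm v"
    using choice[of "\<lambda>d \<phi>. bounded_linear \<phi> \<and> \<phi> d = norm d \<and> (\<forall>v. \<phi> v \<le> norm v)"] by blast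
  show thesis
  proof (rule that[of "\<phi> ` D"])
    show "countable (\<phi> ` D)" using D by simp
  next
    fix y assume y: "y \<in> closure (span (range x))" and 0: "\<And>\<psi>. \<psi> \<in> \<phi> ` D \<Longrightarrow> \<psi> y = 0"
    have "y \<in> closure D" using y closure_mono[OF D(2)] by auto
    have "norm y \<le> 0 + e" if "e > 0" for e
    proof -
      obtain d where d: "d \<in> D" "dist d y < e / 2"
        using \<open>y \<in> closure D\<close> half_gt_zero[OF \<open>e > 0\<close>] unfolding closure_approachable by blast
      \<comment> \<open>As \<open>\<phi> d\<close> vanishes at \<open>y\<close>, its value at
        \<open>d\<close> is controlled by the distance from \<open>d\<close> to
        \<open>y\<close>.\<close>
      have "norm d = \<phi> d (d - y)"
        using 0[of "\<phi> d"] d \<phi>(2)[of d] linear_diff[OF bounded_linear.linear[OF \<phi>(1)], of d d y] by simp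
      then have "norm d \<le> norm (d - y)" using \<phi>(3)[of d "d - y"] by simp
      then show ?thesis using d(2) norm_triangle_ineq2[of y d]
        by (simp add: dist_norm norm_minus_commute)
    qed
    then have "norm y \<le> 0" by (rule field_le_epsilon)
    then show "y = 0" by simp
  qed (use \<phi> in auto)
qed

section \<open>Weak cluster points and convergent subsequences\<close>

text \<open>If \<open>\<phi> x\<close> and \<open>l\<close> differed, the values
  \<open>\<phi> (y j)\<close> would be frequently in a neighbourhood of the one and eventually in a
  disjoint neighbourhood of the other.\<close>

lemma weak_cluster_point_eq_limit:
  fixes \<phi> :: "'b::real_normed_vector \<Rightarrow> real"
  assumes cl: "\<And>U. openin weak_topology U \<Longrightarrow> x \<in> U \<Longrightarrow> \<exists>\<^sub>F j in F. y j \<in> U"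
    and \<phi>: "bounded_linear \<phi>" and l: "((\<lambda>j. \<phi> (y j)) \<longlongrightarrow> l) F"
  shows "\<phi> x = l"
proof (rule ccontr)
  assume "\<phi> x \<noteq> l"
  then obtain U V where UV: "open U" "open V" "\<phi> x \<in> U" "l \<in> V" "U \<inter> V = {}"
    by (meson hausdorff)
  have "\<exists>\<^sub>F j in F. y j \<in> \<phi> -` U"
    using cl[OF openin_weak_topology_vimage[OF \<phi> UV(1)]] UV(3) by blast
  moreover have "\<forall>\<^sub>F j in F. \<phi> (y j) \<in> V"
    using l UV unfolding tendsto_def by blast
  ultimately have "\<exists>\<^sub>F j in F. False"
    by (rule frequently_rev_mp[OF _ eventually_mono]) (use UV in auto)
  then show False by simp
qed

text \<open>The easy half of the Eberlein-Smulian theorem. A diagonal subsequence converges under a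
  countable family of functionals that separates the points of the closed span of the sequence. All
  weak cluster points lie in that closed span, so there is only one, and by compactness it is the limit.\<close>

theorem weakly_compact_imp_sequentially:
  fixes X :: "'b::real_normed_vector set"
  assumes X: "compactin weak_topology X" and xs: "\<And>n::nat. xs n \<in> X"
  obtains r x where "strict_mono (r :: nat \<Rightarrow> nat)" "x \<in> X"
    "limitin weak_topology (\<lambda>n. xs (r n)) x sequentially"
proof -
  let ?Y = "closure (span (range xs))"
  obtain \<Phi> :: "('b \<Rightarrow> real) set" where \<Phi>: "countable \<Phi>" "\<And>\<phi>. \<phi> \<in> \<Phi> \<Longrightarrow> bounded_linear \<phi>"
    and sep: "\<And>y. y \<in> ?Y \<Longrightarrow> (\<And>\<phi>. \<phi> \<in> \<Phi> \<Longrightarrow> \<phi> y = 0) \<Longrightarrow> y = 0"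
    using countable_separating_family[of xs] by blast
  \<comment> \<open>The diagonal argument asks for one bound for the whole family, so each
    functional is divided by a bound \<open>M \<phi>\<close> of its values on
    \<open>X\<close>.\<close>
  have "\<exists>M>0. \<forall>z\<in>X. \<bar>\<phi> z\<bar> \<le> M" if "\<phi> \<in> \<Phi>" for \<phi>
    using weakly_compact_bounded_image[OF X \<Phi>(2)[OF that]] by (auto simp: bounded_pos)
  then obtain M where M: "\<And>\<phi>. \<phi> \<in> \<Phi> \<Longrightarrow> M \<phi> > 0" "\<And>\<phi> z. \<phi> \<in> \<Phi> \<Longrightarrow> z \<in> X \<Longrightarrow> \<bar>\<phi> z\<bar> \<le> M \<phi>"
    by metis
  obtain r :: "nat \<Rightarrow> nat" where r: "strict_mono r"
    and lim: "\<And>\<phi>. \<phi> \<in> \<Phi> \<Longrightarrow> \<exists>l. (\<lambda>n. \<phi> (xs (r n)) / M \<phi>) \<longlonglongrightarrow> l"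
  proof (rule function_convergent_subsequence[of \<Phi> "\<lambda>n \<phi>. \<phi> (xs n) / M \<phi>" 1])
    show "norm (\<phi> (xs n) / M \<phi>) \<le> 1" if "\<phi> \<in> \<Phi>" for n \<phi>
      using M[OF that] xs by (simp add: divide_le_eq)
  qed (use \<Phi> in auto)
  have lim: "\<exists>l. (\<lambda>n. \<phi> (xs (r n))) \<longlonglongrightarrow> l" if \<phi>: "\<phi> \<in> \<Phi>" for \<phi>
  proof -
    obtain l where "(\<lambda>n. \<phi> (xs (r n)) / M \<phi>) \<longlonglongrightarrow> l" using lim[OF \<phi>] by blast
    from tendsto_mult_right[OF this, of "M \<phi>"] show ?thesis
      using M(1)[OF \<phi>] by auto
  qed
  define cl where "cl x \<longleftrightarrow> (\<forall>U. openin weak_topology U \<longrightarrow> x \<in> U \<longrightarrow> (\<exists>\<^sub>F j in sequentially. xs (r j) \<in> U))"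
    for x
  have cl_lim: "\<phi> x = l" if "cl x" "bounded_linear \<phi>" "(\<lambda>n. \<phi> (xs (r n))) \<longlonglongrightarrow> l" for x l and \<phi> :: "'b \<Rightarrow> real"
    by (rule weak_cluster_point_eq_limit[OF _ that(2,3)]) (use that(1) in \<open>simp add: cl_def\<close>)
  \<comment> \<open>A functional vanishing on the span is 0 along the sequence, hence also at each
    cluster point; outside the closed span one could choose it nonzero there.\<close>
  have cl_Y: "x \<in> ?Y" if "cl x" for x
  proof (rule ccontr)
    assume "x \<notin> ?Y"
    then obtain e where e: "e > 0" "\<And>y. y \<in> span (range xs) \<Longrightarrow> e \<le> norm (x - y)"
      unfolding closure_approachable by (auto simp: dist_norm norm_minus_commute not_less)
    obtain \<phi> :: "'b \<Rightarrow> real" where \<phi>: "bounded_linear \<phi>" "\<And>y. y \<in> span (range xs) \<Longrightarrow> \<phi> y = 0" "\<phi> x = e"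
      using separating_functional[OF subspace_span e(2)] e(1) by (metis less_imp_le)
    have "\<phi> x = 0" by (rule cl_lim[OF that \<phi>(1)]) (simp add: \<phi>(2) span_base)
    then show False using \<phi> e by simp
  qed
  \<comment> \<open>At both cluster points each member of \<open>\<Phi>\<close> takes its limit
    along the subsequence, so it vanishes at their difference.\<close>
  have cl_unique: "x = y" if "cl x" "cl y" for x y
  proof -
    have "x - y \<in> ?Y"
      using cl_Y that by (intro subspace_diff subspace_closure subspace_span)
    moreover have "\<phi> (x - y) = 0" if \<phi>: "\<phi> \<in> \<Phi>" for \<phi>
    proof -
      obtain l where "(\<lambda>n. \<phi> (xs (r n))) \<longlonglongrightarrow> l" using lim[OF \<phi>] by blast
      then have "\<phi> x = l" "\<phi> y = l" using cl_lim[OF _ \<Phi>(2)[OF \<phi>]] \<open>cl x\<close> \<open>cl y\<close> by auto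
      then show ?thesis by (simp add: linear_diff bounded_linear.linear \<Phi>(2) that)
    qed
    ultimately show ?thesis using sep[of "x - y"] by simp
  qed
  have cluster: "\<exists>x\<in>K. cl x" if "compactin weak_topology K" "\<exists>\<^sub>F j in sequentially. xs (r j) \<in> K" for K
    using compactin_cluster_point[OF that] unfolding cl_def by metis
  obtain x where x: "x \<in> X" "cl x" using cluster[OF X] xs by auto
  have "limitin weak_topology (\<lambda>n. xs (r n)) x sequentially"
    unfolding limitin_def
  proof (intro conjI allI impI)
    fix U assume U: "openin weak_topology U \<and> x \<in> U"
    show "\<forall>\<^sub>F n in sequentially. xs (r n) \<in> U"
    proof (rule ccontr)
      assume "\<not> (\<forall>\<^sub>F n in sequentially. xs (r n) \<in> U)"
      then have "\<exists>\<^sub>F n in sequentially. xs (r n) \<in> (UNIV - U) \<inter> X"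
        using xs by (simp add: not_eventually)
      moreover have "compactin weak_topology ((UNIV - U) \<inter> X)"
        using U X by (intro closed_Int_compactin) (auto simp: closedin_def double_diff)
      ultimately obtain y where "y \<notin> U" "cl y" using cluster by blast
      then show False using cl_unique x U by blast
    qed
  qed simp
  then show thesis using that r x by blast
qed

section \<open>Bounded linear extensions of prelinear functions\<close>

text \<open>Prelinearity makes the span of the points \<open>(x, g x)\<close> the graph of
  \<open>lin_ext X g\<close>. Continuity at 0 bounds this functional by a multiple of the norm, and
  Hahn-Banach extends it to the whole space.\<close>

lemma prelinear_extends_to_bounded_linear:
  fixes X :: "'b::real_normed_vector set"
  assumes g: "prelinear X g" and cont: "continuous_on (span X) (lin_ext X g)"
  obtains \<phi> :: "'b \<Rightarrow> real" where "bounded_linear \<phi>" "\<And>x. x \<in> X \<Longrightarrow> \<phi> x = g x"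
proof -
  define G where "G = span ((\<lambda>x. (x, g x)) ` X)"
  have G: "subspace G" by (simp add: G_def)
  have ext: "v \<in> span X \<and> a = lin_ext X g v" if "(v, a) \<in> G" for v a
  proof -
    from that obtain t c where t: "finite t" "t \<subseteq> (\<lambda>x. (x, g x)) ` X" "(v, a) = (\<Sum>p\<in>t. c p *\<^sub>R p)"
      unfolding G_def span_explicit by auto
    \<comment> \<open>Numbering the finite set brings the combination into the indexed form of
      \<open>lin_ext_sum\<close>.\<close>
    obtain h where h: "bij_betw h {1..card t} t"
      using ex_bij_betw_nat_finite_1[OF t(1)] by blast
    have eq: "(v, a) = (\<Sum>i=1..card t. c (h i) *\<^sub>R h i)"
      using t(3) sum.reindex_bij_betw[OF h, of "\<lambda>p. c p *\<^sub>R p"] by simp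
    have hX: "fst (h i) \<in> X \<and> snd (h i) = g (fst (h i))" if "i \<in> {1..card t}" for i
      using bij_betwE[OF h] that t(2) by fastforce
    have v: "v = (\<Sum>i=1..card t. c (h i) *\<^sub>R fst (h i))"
      using arg_cong[OF eq, of fst] by (simp add: fst_sum)
    have "a = (\<Sum>i=1..card t. c (h i) * snd (h i))"
      using arg_cong[OF eq, of snd] by (simp add: snd_sum)
    also have "\<dots> = (\<Sum>i=1..card t. c (h i) * g (fst (h i)))"
      using hX by (intro sum.cong) auto
    also have "\<dots> = lin_ext X g v"
      unfolding v using hX by (intro lin_ext_sum[OF g, symmetric]) auto
    finally show ?thesis
      using hX unfolding v by (auto intro!: span_sum span_scale intro: span_base)
  qed
  have zero: "lin_ext X g 0 = 0"
    using ext[of 0 0] subspace_0[OF G] by (simp add: zero_prod_def)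
  obtain d where d: "d > 0" "\<And>v. v \<in> span X \<Longrightarrow> dist v 0 < d \<Longrightarrow> dist (lin_ext X g v) (lin_ext X g 0) < 1"
    using cont span_zero[of X] unfolding continuous_on_iff by (meson zero_less_one)
  have le: "a \<le> 2 / d * norm v" if "(v, a) \<in> G" for v a
  proof (cases "v = 0")
    case True
    then show ?thesis using ext[OF that] zero by simp
  next
    case False
    \<comment> \<open>This scales \<open>v\<close> to norm \<open>d / 2\<close>, inside the ball on
      which the extension differs from its value 0 at the origin by less than 1.\<close>
    define k where "k = d / (2 * norm v)"
    have k: "k > 0" using False d(1) by (simp add: k_def)
    have "(k *\<^sub>R v, k * a) \<in> G" using subspace_scale[OF G that, of k] by simp
    from ext[OF this] have "k *\<^sub>R v \<in> span X" "k * a = lin_ext X g (k *\<^sub>R v)" by auto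
    moreover have "dist (k *\<^sub>R v) 0 < d" using k False d(1) by (simp add: k_def)
    ultimately have "k * a < 1" using d(2)[of "k *\<^sub>R v"] zero by (simp add: dist_real_def)
    then show ?thesis using False d(1) by (simp add: k_def field_simps)
  qed
  obtain \<phi> :: "'b \<Rightarrow> real" where \<phi>: "bounded_linear \<phi>" "\<And>v a. (v, a) \<in> G \<Longrightarrow> \<phi> v = a"
    using hahn_banach_graph[OF G le] d(1) by (metis divide_nonneg_pos zero_le_numeral)
  have "\<phi> x = g x" if "x \<in> X" for x
    by (rule \<phi>(2)) (use that in \<open>auto simp: G_def intro: span_base\<close>)
  then show thesis using that \<phi>(1) by blast
qed

subsection \<open>Directional derivatives of suprema\<close>

text \<open>\<open>V\<close> plays the part of the set of limits of \<open>G\<close> along the sequences that maximize \<open>F\<close>. Each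
  such sequence bounds the quotient from below, and maximizers of \<open>F + t n * H n\<close> up to
  \<open>(t n)\<^sup>2\<close>, which also maximize \<open>F\<close> in the limit, bound it from above.\<close>

lemma difference_quotient_Sup_tendsto:
  fixes F G :: "'a \<Rightarrow> real" and H :: "nat \<Rightarrow> 'a \<Rightarrow> real"
  assumes S: "S \<noteq> {}" and F: "bounded (F ` S)" and G: "bounded (G ` S)"
    and t: "\<And>n. 0 < t n" "t \<longlonglongrightarrow> 0"
    and H: "\<And>n x. x \<in> S \<Longrightarrow> \<bar>H n x - G x\<bar> \<le> e n" and e: "e \<longlonglongrightarrow> 0"
    and V1: "\<And>xs. (\<And>n::nat. xs n \<in> S) \<Longrightarrow> (\<lambda>n. F (xs n)) \<longlonglongrightarrow> (SUP x\<in>S. F x) \<Longrightarrow>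
      \<exists>r v. strict_mono (r::nat \<Rightarrow> nat) \<and> v \<in> V \<and> (\<lambda>n. G (xs (r n))) \<longlonglongrightarrow> v"
    and V2: "\<And>v. v \<in> V \<Longrightarrow>
      \<exists>xs. (\<forall>n::nat. xs n \<in> S) \<and> (\<lambda>n. F (xs n)) \<longlonglongrightarrow> (SUP x\<in>S. F x) \<and> (\<lambda>n. G (xs n)) \<longlonglongrightarrow> v"
  shows "(\<lambda>n. ((SUP x\<in>S. F x + t n * H n x) - (SUP x\<in>S. F x)) / t n) \<longlonglongrightarrow> Sup V"
proof -
  define s where "s = (SUP x\<in>S. F x)"
  define P where "P n = (SUP x\<in>S. F x + t n * H n x)" for n
  define Q where "Q n = (P n - s) / t n" for n
  obtain A B where A: "\<And>x. x \<in> S \<Longrightarrow> \<bar>F x\<bar> \<le> A" and B: "\<And>x. x \<in> S \<Longrightarrow> \<bar>G x\<bar> \<le> B"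
    using F G by (auto simp: bounded_iff)
  have HB: "\<bar>H n x\<bar> \<le> B + e n" if "x \<in> S" for n x
    using H[OF that, of n] B[OF that] by linarith
  have tHB: "\<bar>t n * H n x\<bar> \<le> t n * (B + e n)" if "x \<in> S" for n x
    using HB[OF that, of n] t(1)[of n] by (simp add: abs_mult)
  have tG: "t n * (G x - e n) \<le> t n * H n x" "t n * H n x \<le> t n * (G x + e n)" if "x \<in> S" for n x
    using H[OF that, of n] t(1)[of n] by (auto simp: mult_le_cancel_left_pos)
  have leP: "F x + t n * H n x \<le> P n" if "x \<in> S" for n x
    unfolding P_def
  proof (rule cSUP_upper[OF that])
    show "bdd_above ((\<lambda>x. F x + t n * H n x) ` S)"
      using A tHB by (intro bdd_aboveI2[of _ _ "A + t n * (B + e n)"]) (smt (verit))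
  qed
  have les: "F x \<le> s" if "x \<in> S" for x
    unfolding s_def using A by (intro cSUP_upper[OF that] bdd_aboveI2[of _ _ A]) (smt (verit))
  \<comment> \<open>The slack is quadratic so that it contributes only \<open>t n\<close> after
    division by \<open>t n\<close>.\<close>
  have "\<exists>x\<in>S. P n - t n * t n < F x + t n * H n x" for n
  proof (rule ccontr)
    assume "\<not> ?thesis"
    then have "P n \<le> P n - t n * t n" unfolding P_def[of n]
      by (intro cSUP_least[OF S]) (auto simp: not_less P_def)
    then show False using mult_pos_pos[OF t(1) t(1), of n n] by linarith
  qed
  then obtain xs where xs: "\<And>n. xs n \<in> S" and near: "\<And>n. P n - t n * t n < F (xs n) + t n * H n (xs n)"
    by metis
  have sP: "s \<le> P n + t n * (B + e n)" for n
    unfolding s_def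
  proof (rule cSUP_least[OF S])
    show "F x \<le> P n + t n * (B + e n)" if "x \<in> S" for x
      using leP[OF that, of n] tHB[OF that, of n] by linarith
  qed
  have F_lim: "(\<lambda>n. F (xs n)) \<longlonglongrightarrow> s"
  proof (rule tendsto_sandwich)
    \<comment> \<open>The perturbation \<open>t n * H n\<close> costs at most
      \<open>t n * (B + e n)\<close> twice: in comparing \<open>P n\<close> with \<open>s\<close>,
      and in comparing the perturbed value at \<open>xs n\<close> with
      \<open>F (xs n)\<close>.\<close>
    show "\<forall>\<^sub>F n in sequentially. s - 2 * (t n * (B + e n)) - t n * t n \<le> F (xs n)"
    proof (intro always_eventually allI)
      show "s - 2 * (t n * (B + e n)) - t n * t n \<le> F (xs n)" for n
        using near[of n] sP[of n] tHB[OF xs[of n], of n] by linarith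
    qed
    show "\<forall>\<^sub>F n in sequentially. F (xs n) \<le> s" using les xs by simp
    have "(\<lambda>n. s - 2 * (t n * (B + e n)) - t n * t n) \<longlonglongrightarrow> s - 2 * (0 * (B + 0)) - 0 * 0"
      by (intro tendsto_intros t e)
    then show "(\<lambda>n. s - 2 * (t n * (B + e n)) - t n * t n) \<longlonglongrightarrow> s" by simp
  qed simp
  have upper: "Q n \<le> G (xs n) + e n + t n" for n
  proof -
    have "P n - s \<le> t n * (G (xs n) + e n + t n)"
      using near[of n] les[OF xs[of n]] tG(2)[OF xs[of n], of n] by (simp add: algebra_simps)
    then show ?thesis using t(1)[of n] by (simp add: Q_def divide_le_eq mult.commute)
  qed
  have V_le: "v - e n \<le> Q n" if v: "v \<in> V" for v n
  proof -
    obtain ys where ys: "\<And>k. ys k \<in> S" "(\<lambda>k. F (ys k)) \<longlonglongrightarrow> s" "(\<lambda>k. G (ys k)) \<longlonglongrightarrow> v"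
      using V2[OF v, folded s_def] by blast
    \<comment> \<open>Here \<open>n\<close> stays fixed while \<open>k\<close> tends to
      infinity.\<close>
    have "F (ys k) + t n * (G (ys k) - e n) \<le> P n" for k
      using leP[OF ys(1), of k n] tG(1)[OF ys(1), of n k] by linarith
    moreover have "(\<lambda>k. F (ys k) + t n * (G (ys k) - e n)) \<longlonglongrightarrow> s + t n * (v - e n)"
      by (intro tendsto_intros ys)
    ultimately have "s + t n * (v - e n) \<le> P n" by (intro LIMSEQ_le_const2) auto
    then show ?thesis using t(1)[of n] by (simp add: Q_def le_divide_eq algebra_simps)
  qed
  \<comment> \<open>Boundedness, for which any one index will do, and nonemptiness make
    \<open>Sup V\<close> a true least upper bound.\<close>
  have bdd: "bdd_above V"
  proof (rule bdd_aboveI)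
    show "v \<le> Q 0 + e 0" if "v \<in> V" for v using V_le[OF that, of 0] by simp
  qed
  have "V \<noteq> {}" using V1[of xs] xs F_lim unfolding s_def by blast
  then have lower: "Sup V - e n \<le> Q n" for n
    using cSup_least[of V "Q n + e n"] V_le[of _ n] by (simp add: algebra_simps)
  have "Q \<longlonglongrightarrow> Sup V"
  proof (rule order_tendstoI)
    fix a assume "a < Sup V"
    moreover have "(\<lambda>n. Sup V - e n) \<longlonglongrightarrow> Sup V - 0" by (intro tendsto_intros e)
    ultimately have "\<forall>\<^sub>F n in sequentially. a < Sup V - e n" by (intro order_tendstoD(1)) auto
    then show "\<forall>\<^sub>F n in sequentially. a < Q n"
      by eventually_elim (use lower less_le_trans in blast)
  next
    fix a assume a: "Sup V < a"
    \<comment> \<open>If \<open>a \<le> Q n\<close> held infinitely often, \<open>V1\<close> along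
      those indices would produce an element of \<open>V\<close> that is at least
      \<open>a\<close>.\<close>
    show "\<forall>\<^sub>F n in sequentially. Q n < a"
    proof (rule ccontr)
      assume "\<not> ?thesis"
      then have "infinite {n. a \<le> Q n}"
        by (simp add: not_eventually not_less frequently_sequentially infinite_nat_iff_unbounded_le)
      then obtain r :: "nat \<Rightarrow> nat" where r: "strict_mono r" "\<And>n. a \<le> Q (r n)"
        using infinite_enumerate by blast
      have "\<exists>r' v. strict_mono (r'::nat \<Rightarrow> nat) \<and> v \<in> V \<and> (\<lambda>n. G (xs (r (r' n)))) \<longlonglongrightarrow> v"
      proof (rule V1)
        show "(\<lambda>n. F (xs (r n))) \<longlonglongrightarrow> (SUP x\<in>S. F x)"
          using LIMSEQ_subseq_LIMSEQ[OF F_lim r(1)] by (simp add: o_def s_def)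
      qed (rule xs)
      then obtain r' v where r': "strict_mono (r'::nat \<Rightarrow> nat)" "v \<in> V"
        and v: "(\<lambda>n. G (xs (r (r' n)))) \<longlonglongrightarrow> v" by blast
      have sub: "strict_mono (r \<circ> r')" using r r' by (intro strict_mono_o)
      have "(\<lambda>n. G (xs (r (r' n))) + e (r (r' n)) + t (r (r' n))) \<longlonglongrightarrow> v + 0 + 0"
        using LIMSEQ_subseq_LIMSEQ[OF e sub] LIMSEQ_subseq_LIMSEQ[OF t(2) sub] v
        by (intro tendsto_add) (auto simp: o_def)
      moreover have "a \<le> G (xs (r (r' n))) + e (r (r' n)) + t (r (r' n))" for n
        using r(2)[of "r' n"] upper[of "r (r' n)"] by linarith
      ultimately have "a \<le> v" by (intro LIMSEQ_le_const[of _ v a]) auto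
      then show False using cSup_upper[OF r'(2) bdd] a by simp
    qed
  qed
  then show ?thesis unfolding Q_def P_def s_def .
qed

section \<open>Hadamard derivatives on the space of bounded functions\<close>

lemma abs_le_linfty_norm:
  assumes "u \<in> linfty X" "x \<in> X"
  shows "\<bar>u x\<bar> \<le> linfty_norm X u"
  unfolding linfty_norm_def
proof (rule cSUP_upper[OF assms(2)])
  show "bdd_above ((\<lambda>x. \<bar>u x\<bar>) ` X)"
    using assms(1) by (auto simp: linfty_def bounded_iff intro: bdd_aboveI2)
qed

text \<open>The signs \<open>c\<close> let one lemma serve suprema (\<open>c = 1\<close>), negated infima (\<open>c = -1\<close>) and the
  norm, which is a supremum over two signed copies of \<open>X\<close>.\<close>

lemma has_hadamard_dir_derivative_Sup:
  fixes S :: "'c set" and q :: "'c \<Rightarrow> 'a" and c :: "'c \<Rightarrow> real"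
  assumes S: "S \<noteq> {}" and q: "\<And>p. p \<in> S \<Longrightarrow> q p \<in> X" and c: "\<And>p. p \<in> S \<Longrightarrow> \<bar>c p\<bar> = 1"
    and \<phi>: "\<And>u. u \<in> linfty X \<Longrightarrow> \<phi> u = (SUP p\<in>S. c p * u (q p))"
    and f: "f \<in> linfty X" and D: "D \<subseteq> linfty X"
    and V1: "\<And>h ps. h \<in> D \<Longrightarrow> (\<And>n::nat. ps n \<in> S) \<Longrightarrow> (\<lambda>n. c (ps n) * f (q (ps n))) \<longlonglongrightarrow> \<phi> f \<Longrightarrow>
      \<exists>r v. strict_mono (r::nat \<Rightarrow> nat) \<and> v \<in> V h \<and> (\<lambda>n. c (ps (r n)) * h (q (ps (r n)))) \<longlonglongrightarrow> v"
    and V2: "\<And>h v. h \<in> D \<Longrightarrow> v \<in> V h \<Longrightarrow>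
      \<exists>ps. (\<forall>n::nat. ps n \<in> S) \<and> (\<lambda>n. c (ps n) * f (q (ps n))) \<longlonglongrightarrow> \<phi> f \<and>
        (\<lambda>n. c (ps n) * h (q (ps n))) \<longlonglongrightarrow> v"
  shows "has_hadamard_dir_derivative (linfty X) (linfty_norm X) \<phi> (\<lambda>h. Sup (V h)) f D"
  unfolding has_hadamard_dir_derivative_def
proof (intro conjI ballI allI impI f D)
  fix h and t :: "nat \<Rightarrow> real" and hs :: "nat \<Rightarrow> 'a \<Rightarrow> real"
  assume h: "h \<in> D" and "(\<forall>n. 0 < t n) \<and> t \<longlonglongrightarrow> 0 \<and> (\<forall>n. hs n \<in> linfty X) \<and>
    (\<lambda>n. linfty_norm X (hs n - h)) \<longlonglongrightarrow> 0"
  then have t: "\<And>n. 0 < t n" "t \<longlonglongrightarrow> 0" and hs: "\<And>n. hs n \<in> linfty X"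
    and e: "(\<lambda>n. linfty_norm X (hs n - h)) \<longlonglongrightarrow> 0" by auto
  have hX: "h \<in> linfty X" using h D by blast
  have bnd: "bounded ((\<lambda>p. c p * u (q p)) ` S)" if u: "u \<in> linfty X" for u
    unfolding bounded_iff
    using abs_le_linfty_norm[OF u q] c by (auto simp: abs_mult)
  have "(\<lambda>n. ((SUP p\<in>S. c p * f (q p) + t n * (c p * hs n (q p))) - (SUP p\<in>S. c p * f (q p))) / t n)
      \<longlonglongrightarrow> Sup (V h)"
  proof (rule difference_quotient_Sup_tendsto[OF S bnd[OF f] bnd[OF hX] t _ e])
    fix n p assume p: "p \<in> S"
    have "hs n - h \<in> linfty X" by (intro subspace_diff subspace_linfty hs hX)
    from abs_le_linfty_norm[OF this q[OF p]]
    show "\<bar>c p * hs n (q p) - c p * h (q p)\<bar> \<le> linfty_norm X (hs n - h)"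
      using c[OF p] by (simp add: abs_mult flip: right_diff_distrib)
  qed (use V1[OF h] V2[OF h] \<phi>[OF f] in auto)
  moreover have "(SUP p\<in>S. c p * f (q p) + t n * (c p * hs n (q p))) = \<phi> (f + t n *\<^sub>R hs n)" for n
  proof -
    have "f + t n *\<^sub>R hs n \<in> linfty X" by (intro subspace_add subspace_scale subspace_linfty f hs)
    then show ?thesis by (simp add: \<phi> scaleR_fun_def algebra_simps)
  qed
  ultimately have "(\<lambda>n. (\<phi> (f + t n *\<^sub>R hs n) - \<phi> f) /\<^sub>R t n) \<longlonglongrightarrow> Sup (V h)"
    by (simp add: \<phi>[OF f] divide_inverse mult.commute)
  then show "(\<lambda>n. norm ((\<phi> (f + t n *\<^sub>R hs n) - \<phi> f) /\<^sub>R t n - Sup (V h))) \<longlonglongrightarrow> 0"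
    by (intro tendsto_norm_zero LIM_zero)
qed

lemma has_hadamard_dir_derivative_diff:
  assumes "has_hadamard_dir_derivative D nrm \<phi> \<phi>' \<theta> D\<^sub>0" "has_hadamard_dir_derivative D nrm \<psi> \<psi>' \<theta> D\<^sub>0"
  shows "has_hadamard_dir_derivative D nrm (\<lambda>u. \<phi> u - \<psi> u) (\<lambda>h. \<phi>' h - \<psi>' h) \<theta> D\<^sub>0"
  unfolding has_hadamard_dir_derivative_def
proof (intro conjI ballI allI impI)
  fix h and t :: "nat \<Rightarrow> real" and hs assume h: "h \<in> D\<^sub>0" and *: "(\<forall>n. 0 < t n) \<and> t \<longlonglongrightarrow> 0 \<and> (\<forall>n. hs n \<in> D) \<and>
    (\<lambda>n. nrm (hs n - h)) \<longlonglongrightarrow> 0"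
  have "(\<lambda>n. (\<phi> (\<theta> + t n *\<^sub>R hs n) - \<phi> \<theta>) /\<^sub>R t n - \<phi>' h) \<longlonglongrightarrow> 0"
       "(\<lambda>n. (\<psi> (\<theta> + t n *\<^sub>R hs n) - \<psi> \<theta>) /\<^sub>R t n - \<psi>' h) \<longlonglongrightarrow> 0"
    using assms h * unfolding has_hadamard_dir_derivative_def by (blast intro: tendsto_norm_zero_cancel)+
  from tendsto_norm_zero[OF tendsto_diff[OF this, unfolded diff_0_right]]
  show "(\<lambda>n. norm ((\<phi> (\<theta> + t n *\<^sub>R hs n) - \<psi> (\<theta> + t n *\<^sub>R hs n) - (\<phi> \<theta> - \<psi> \<theta>)) /\<^sub>R t n - (\<phi>' h - \<psi>' h))) \<longlonglongrightarrow> 0"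
    by (simp add: scaleR_diff_right algebra_simps)
qed (use assms in \<open>auto simp: has_hadamard_dir_derivative_def\<close>)

text \<open>Together with the difference rule this differentiates negated maps, as needed for the
  infimum.\<close>

lemma has_hadamard_dir_derivative_zero:
  assumes "\<theta> \<in> D" "D\<^sub>0 \<subseteq> D"
  shows "has_hadamard_dir_derivative D nrm (\<lambda>u. 0) (\<lambda>h. 0) \<theta> D\<^sub>0"
  using assms by (simp add: has_hadamard_dir_derivative_def)

text \<open>The functionals of the theorem are prescribed on \<open>linfty X\<close> only. Every
  point at which the difference quotient evaluates them lies in the subspace
  \<open>D\<close>.\<close>

lemma has_hadamard_dir_derivative_cong:
  assumes "subspace D"
    and "\<And>u. u \<in> D \<Longrightarrow> \<phi> u = \<psi> u" and "\<And>h. h \<in> D\<^sub>0 \<Longrightarrow> \<phi>' h = \<psi>' h"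
    and "has_hadamard_dir_derivative D nrm \<psi> \<psi>' \<theta> D\<^sub>0"
  shows "has_hadamard_dir_derivative D nrm \<phi> \<phi>' \<theta> D\<^sub>0"
  using assms(2-) subspace_add[OF assms(1) _ subspace_scale[OF assms(1)]]
  unfolding has_hadamard_dir_derivative_def by simp

section \<open>Supremum and infimum on a weakly compact set\<close>

text \<open>Here continuity of the linear extensions enters: on \<open>X\<close> the function
  \<open>g\<close> agrees with a bounded linear functional, which respects weak limits.\<close>

lemma limitin_weak_topology_C_pl:
  fixes X :: "'b::real_normed_vector set"
  assumes ext: "\<forall>g\<in>C_pl X. continuous_on (span X) (lin_ext X g)" and g: "g \<in> C_pl X"
    and lim: "limitin weak_topology xs x sequentially" and X: "\<And>n. xs n \<in> X" "x \<in> X"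
  shows "(\<lambda>n. g (xs n)) \<longlonglongrightarrow> g x"
proof -
  obtain \<phi> :: "'b \<Rightarrow> real" where \<phi>: "bounded_linear \<phi>" "\<And>x. x \<in> X \<Longrightarrow> \<phi> x = g x"
    using prelinear_extends_to_bounded_linear[of X g] ext g by (auto simp: C_pl_def)
  show ?thesis
    using limitin_weak_topology_imp_tendsto[OF lim \<phi>(1)] \<phi>(2) X by simp
qed

lemma C_pl_subset_linfty: "C_pl X \<subseteq> linfty X"
  by (auto simp: C_pl_def)

text \<open>On the reals \<open>Inf\<close> is defined as the negative of \<open>Sup\<close> of the
  negated set, so the identity covers empty and unbounded sets as well.\<close>

lemma uminus_SUP_uminus:
  fixes g :: "'a \<Rightarrow> real"
  shows "(SUP x\<in>A. - g x) = - (INF x\<in>A. g x)"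
  by (simp add: Inf_real_def image_image)

text \<open>The limit set for the direction \<open>g\<close> is the image of \<open>A0w\<close>
  under \<open>c * g\<close>. A maximizing sequence has a subsequence with a weak limit in
  \<open>A0w\<close>, and conversely the sequences in the definition of \<open>A0w\<close> realize
  every value in the image.\<close>

lemma hadamard_derivative_SUP_A0w:
  fixes X :: "'b::real_normed_vector set"
  assumes X: "X \<noteq> {}" "compactin weak_topology X"
    and ext: "\<forall>g\<in>C_pl X. continuous_on (span X) (lin_ext X g)" and f: "f \<in> linfty X"
    and c: "\<bar>c\<bar> = 1"
  shows "has_hadamard_dir_derivative (linfty X) (linfty_norm X) (\<lambda>u. SUP x\<in>X. c * u x)
    (\<lambda>g. SUP x\<in>A0w X (\<lambda>x. c * f x). c * g x) f (C_pl X)"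
proof (rule has_hadamard_dir_derivative_Sup[where S = X and q = "\<lambda>x. x" and c = "\<lambda>_. c"])
  fix h and ps :: "nat \<Rightarrow> 'b"
  assume h: "h \<in> C_pl X" and ps: "\<And>n. ps n \<in> X"
    and lim: "(\<lambda>n. c * f (ps n)) \<longlonglongrightarrow> (SUP x\<in>X. c * f x)"
  obtain r x where r: "strict_mono r" and x: "x \<in> X"
    and w: "limitin weak_topology (\<lambda>n. ps (r n)) x sequentially"
    by (rule weakly_compact_imp_sequentially[OF X(2) ps])
  have "(\<lambda>n. c * f (ps (r n))) \<longlonglongrightarrow> (SUP x\<in>X. c * f x)"
    using LIMSEQ_subseq_LIMSEQ[OF lim r] by (simp add: o_def)
  then have "x \<in> A0w X (\<lambda>x. c * f x)"
    unfolding A0w_def using ps x w by (intro CollectI conjI exI[of _ "\<lambda>n. ps (r n)"]) auto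
  moreover have "(\<lambda>n. c * h (ps (r n))) \<longlonglongrightarrow> c * h x"
    by (intro tendsto_mult_left limitin_weak_topology_C_pl[OF ext h w ps x])
  ultimately show "\<exists>r v. strict_mono r \<and> v \<in> (\<lambda>x. c * h x) ` A0w X (\<lambda>x. c * f x) \<and>
      (\<lambda>n. c * h (ps (r n))) \<longlonglongrightarrow> v"
    using r by (intro exI[of _ r] exI[of _ "c * h x"]) auto
next
  fix h v assume h: "h \<in> C_pl X" and "v \<in> (\<lambda>x. c * h x) ` A0w X (\<lambda>x. c * f x)"
  then obtain x xs where v: "v = c * h x" and x: "x \<in> X" and xs: "\<And>n. xs n \<in> X"
    and w: "limitin weak_topology xs x sequentially"
    and lim: "(\<lambda>n. c * f (xs n)) \<longlonglongrightarrow> (SUP x\<in>X. c * f x)"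
    unfolding A0w_def by blast
  have "(\<lambda>n. c * h (xs n)) \<longlonglongrightarrow> v"
    unfolding v by (intro tendsto_mult_left limitin_weak_topology_C_pl[OF ext h w xs x])
  then show "\<exists>ps. (\<forall>n. ps n \<in> X) \<and> (\<lambda>n. c * f (ps n)) \<longlonglongrightarrow> (SUP x\<in>X. c * f x) \<and>
      (\<lambda>n. c * h (ps n)) \<longlonglongrightarrow> v"
    using xs lim by (intro exI[of _ xs]) simp
qed (use X f c C_pl_subset_linfty in auto)

lemma B0w_eq_A0w_uminus: "B0w X f = A0w X (\<lambda>x. - f x)"
  by (simp add: A0w_def B0w_def uminus_SUP_uminus tendsto_minus_cancel_left)

text \<open>The infimum of \<open>u\<close> is 0 minus the supremum of \<open>- u\<close>, which is
  the case \<open>c = -1\<close>.\<close>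

lemma hadamard_derivative_INF_B0w:
  fixes X :: "'b::real_normed_vector set"
  assumes X: "X \<noteq> {}" "compactin weak_topology X"
    and ext: "\<forall>g\<in>C_pl X. continuous_on (span X) (lin_ext X g)" and f: "f \<in> linfty X"
  shows "has_hadamard_dir_derivative (linfty X) (linfty_norm X) (\<lambda>u. INF x\<in>X. u x)
    (\<lambda>g. INF x\<in>B0w X f. g x) f (C_pl X)"
  using has_hadamard_dir_derivative_diff[OF
      has_hadamard_dir_derivative_zero[OF f C_pl_subset_linfty]
      hadamard_derivative_SUP_A0w[OF X ext f, of "-1"]]
  by (simp add: uminus_SUP_uminus B0w_eq_A0w_uminus)

text \<open>Weak sequential continuity of \<open>f\<close> makes the weak limit of a maximizing
  sequence a maximizer; in the other direction a constant sequence suffices.\<close>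

lemma A0w_eq_M_plus:
  assumes ext: "\<forall>g\<in>C_pl X. continuous_on (span X) (lin_ext X g)" and f: "f \<in> C_pl X"
  shows "A0w X f = M_plus X f"
proof (intro equalityI subsetI)
  fix x assume "x \<in> A0w X f"
  then obtain xs where x: "x \<in> X" and xs: "\<And>n. xs n \<in> X" and w: "limitin weak_topology xs x sequentially"
    and lim: "(\<lambda>n. f (xs n)) \<longlonglongrightarrow> (SUP y\<in>X. f y)"
    unfolding A0w_def by blast
  show "x \<in> M_plus X f"
    using x LIMSEQ_unique[OF limitin_weak_topology_C_pl[OF ext f w xs x] lim] by (simp add: M_plus_def)
next
  fix x assume x: "x \<in> M_plus X f"
  have "\<exists>xs. (\<forall>n. xs n \<in> X) \<and> limitin weak_topology xs x sequentially \<and> (\<lambda>n. f (xs n)) \<longlonglongrightarrow> (SUP y\<in>X. f y)"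
    by (rule exI[of _ "\<lambda>_. x"]) (use x in \<open>simp add: M_plus_def\<close>)
  then show "x \<in> A0w X f"
    using x by (simp add: A0w_def M_plus_def)
qed

lemma B0w_eq_M_minus:
  assumes ext: "\<forall>g\<in>C_pl X. continuous_on (span X) (lin_ext X g)" and f: "f \<in> C_pl X"
  shows "B0w X f = M_minus X f"
proof (intro equalityI subsetI)
  fix x assume "x \<in> B0w X f"
  then obtain xs where x: "x \<in> X" and xs: "\<And>n. xs n \<in> X" and w: "limitin weak_topology xs x sequentially"
    and lim: "(\<lambda>n. f (xs n)) \<longlonglongrightarrow> (INF y\<in>X. f y)"
    unfolding B0w_def by blast
  show "x \<in> M_minus X f"
    using x LIMSEQ_unique[OF limitin_weak_topology_C_pl[OF ext f w xs x] lim] by (simp add: M_minus_def)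
next
  fix x assume x: "x \<in> M_minus X f"
  have "\<exists>xs. (\<forall>n. xs n \<in> X) \<and> limitin weak_topology xs x sequentially \<and> (\<lambda>n. f (xs n)) \<longlonglongrightarrow> (INF y\<in>X. f y)"
    by (rule exI[of _ "\<lambda>_. x"]) (use x in \<open>simp add: M_minus_def\<close>)
  then show "x \<in> B0w X f"
    using x by (simp add: B0w_def M_minus_def)
qed

section \<open>The derivative of the norm\<close>

text \<open>An absolute value is the larger of the two signed values. This brings the norm into the
  form required by \<open>has_hadamard_dir_derivative_Sup\<close>.\<close>

lemma linfty_norm_eq_SUP_signed:
  assumes X: "X \<noteq> {}" and u: "u \<in> linfty X"
  shows "linfty_norm X u = (SUP p\<in>X \<times> {1, -1}. snd p * u (fst p))"
proof (rule antisym)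
  have "bdd_above ((\<lambda>p. snd p * u (fst p)) ` (X \<times> {1, -1}))"
    using abs_le_linfty_norm[OF u] by (intro bdd_aboveI2[of _ _ "linfty_norm X u"]) (fastforce simp: abs_le_iff)
  then have le: "c * u x \<le> (SUP p\<in>X \<times> {1, -1}. snd p * u (fst p))" if "x \<in> X" "c \<in> {1, -1}" for x c
    using cSUP_upper[of "(x, c)" "X \<times> {1, -1}" "\<lambda>p. snd p * u (fst p)"] that by simp
  show "linfty_norm X u \<le> (SUP p\<in>X \<times> {1, -1}. snd p * u (fst p))"
    unfolding linfty_norm_def using le[of _ 1] le[of _ "-1"]
    by (intro cSUP_least[OF X]) (simp add: abs_le_iff)
  show "(SUP p\<in>X \<times> {1, -1}. snd p * u (fst p)) \<le> linfty_norm X u"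
    using X abs_le_linfty_norm[OF u] by (intro cSUP_least) (fastforce simp: abs_le_iff)+
qed

lemma convergent_subsequence_of_signs:
  fixes s :: "nat \<Rightarrow> real"
  assumes "\<And>n. s n \<in> {1, -1}"
  obtains r c where "strict_mono (r :: nat \<Rightarrow> nat)" "c \<in> {1, -1}" "(\<lambda>n. s (r n)) \<longlonglongrightarrow> c"
proof -
  have "seq_compact {1, -1::real}" by (intro compact_imp_seq_compact finite_imp_compact) simp
  moreover have "\<forall>n. s n \<in> {1, -1}" using assms by blast
  ultimately obtain c r where "c \<in> {1, -1}" "strict_mono (r :: nat \<Rightarrow> nat)" "(s \<circ> r) \<longlonglongrightarrow> c"
    by (rule seq_compactE)
  then show thesis using that[of r c] by (simp add: o_def)
qed

text \<open>A maximizing sequence of signed points has a subsequence along which the points converge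
  weakly and the signs converge. The limit point maximizes the modulus of \<open>f\<close>, and the
  limit sign is the sign of \<open>f\<close> there.\<close>

lemma hadamard_derivative_linfty_norm:
  fixes X :: "'b::real_normed_vector set"
  assumes X: "X \<noteq> {}" "compactin weak_topology X"
    and ext: "\<forall>g\<in>C_pl X. continuous_on (span X) (lin_ext X g)" and f: "f \<in> C_pl X" "f \<noteq> 0"
  shows "has_hadamard_dir_derivative (linfty X) (linfty_norm X) (linfty_norm X)
    (\<lambda>g. SUP x\<in>M_plus X (\<lambda>x. \<bar>f x\<bar>). g x * sgn (f x)) f (C_pl X)"
proof (rule has_hadamard_dir_derivative_Sup[where S = "X \<times> {1, -1}" and q = fst and c = snd])
  have fX: "f \<in> linfty X" using f C_pl_subset_linfty by blast
  then show "f \<in> linfty X" .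
  \<comment> \<open>Since \<open>f\<close> vanishes off \<open>X\<close>, a point where it is
    nonzero lies in \<open>X\<close> and makes the norm positive; hence \<open>f\<close> is nonzero
    at every maximizer of its modulus.\<close>
  obtain y where y: "f y \<noteq> 0" using f(2) by (auto simp: fun_eq_iff)
  then have "y \<in> X" using fX by (auto simp: linfty_def)
  then have pos: "linfty_norm X f > 0" using abs_le_linfty_norm[OF fX] y by fastforce
  {
    fix h and ps :: "nat \<Rightarrow> 'b \<times> real"
    assume h: "h \<in> C_pl X" and ps: "\<And>n. ps n \<in> X \<times> {1, -1}"
      and lim: "(\<lambda>n. snd (ps n) * f (fst (ps n))) \<longlonglongrightarrow> linfty_norm X f"
    have fst: "fst (ps n) \<in> X" and snd: "snd (ps n) \<in> {1, -1}" for n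
      using ps[of n] by auto
    obtain r x where r: "strict_mono r" and x: "x \<in> X"
      and w: "limitin weak_topology (\<lambda>n. fst (ps (r n))) x sequentially"
      by (rule weakly_compact_imp_sequentially[OF X(2) fst])
    obtain r' c where r': "strict_mono (r' :: nat \<Rightarrow> nat)" and c: "c \<in> {1, -1}"
      and lim_c: "(\<lambda>n. snd (ps (r (r' n)))) \<longlonglongrightarrow> c"
      by (rule convergent_subsequence_of_signs[OF snd])
    have lim_g: "(\<lambda>n. snd (ps (r (r' n))) * g (fst (ps (r (r' n))))) \<longlonglongrightarrow> c * g x" if "g \<in> C_pl X" for g
      using LIMSEQ_subseq_LIMSEQ[OF limitin_weak_topology_C_pl[OF ext that w fst x] r']
      by (intro tendsto_mult lim_c) (simp add: o_def)
    have rr: "strict_mono (r \<circ> r')" using r r' by (rule strict_mono_o)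
    have "c * f x = linfty_norm X f"
      using LIMSEQ_subseq_LIMSEQ[OF lim rr] by (intro LIMSEQ_unique[OF lim_g[OF f(1)]]) (simp add: o_def)
    \<comment> \<open>With \<open>c\<close> being 1 or -1, positivity of \<open>c * f x\<close>
      fixes both the modulus and the sign of \<open>f x\<close>.\<close>
    then have "\<bar>f x\<bar> = linfty_norm X f" "sgn (f x) = c" using c pos by auto
    then have "c * h x \<in> (\<lambda>x. h x * sgn (f x)) ` M_plus X (\<lambda>x. \<bar>f x\<bar>)"
      using x by (auto simp: M_plus_def linfty_norm_def mult.commute)
    then show "\<exists>r v. strict_mono r \<and> v \<in> (\<lambda>x. h x * sgn (f x)) ` M_plus X (\<lambda>x. \<bar>f x\<bar>) \<and>
        (\<lambda>n. snd (ps (r n)) * h (fst (ps (r n)))) \<longlonglongrightarrow> v"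
      using rr lim_g[OF h] by (intro exI[of _ "r \<circ> r'"] exI[of _ "c * h x"]) simp
  next
    fix h v assume "v \<in> (\<lambda>x. h x * sgn (f x)) ` M_plus X (\<lambda>x. \<bar>f x\<bar>)"
    then obtain x where v: "v = h x * sgn (f x)" and x: "x \<in> X" "\<bar>f x\<bar> = linfty_norm X f"
      by (auto simp: M_plus_def linfty_norm_def)
    then have "f x \<noteq> 0" using pos by auto
    \<comment> \<open>Repeating a maximizer paired with its sign gives a constant maximizing
      sequence.\<close>
    then have "(x, sgn (f x)) \<in> X \<times> {1, -1}" using x(1) by (auto simp: sgn_if)
    then show "\<exists>ps. (\<forall>n::nat. ps n \<in> X \<times> {1, -1}) \<and> (\<lambda>n. snd (ps n) * f (fst (ps n))) \<longlonglongrightarrow> linfty_norm X f \<and>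
        (\<lambda>n. snd (ps n) * h (fst (ps n))) \<longlonglongrightarrow> v"
      using x(2) by (intro exI[of _ "\<lambda>_. (x, sgn (f x))"]) (simp add: v mult.commute abs_sgn)
  }
qed (use X linfty_norm_eq_SUP_signed[OF X(1)] C_pl_subset_linfty in auto)

theorem corollary2p6:
  fixes X :: "'b::banach set"
    and \<delta> \<sigma> \<iota> \<alpha> :: "('b \<Rightarrow> real) \<Rightarrow> real"
    and f :: "'b \<Rightarrow> real"
  assumes nonempty: "X \<noteq> {}"
    and weakly_compact: "compactin weak_topology X"
    and ext_continuous: "\<forall>g\<in>C_pl X. continuous_on (span X) (lin_ext X g)"
    and \<delta>: "\<forall>u\<in>linfty X. \<delta> u = linfty_norm X u"
    and \<sigma>: "\<forall>u\<in>linfty X. \<sigma> u = (SUP x\<in>X. u x)"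
    and \<iota>: "\<forall>u\<in>linfty X. \<iota> u = (INF x\<in>X. u x)"
    and \<alpha>: "\<forall>u\<in>linfty X. \<alpha> u = (SUP x\<in>X. u x) - (INF x\<in>X. u x)"
    and f: "f \<in> linfty X"
  shows "has_hadamard_dir_derivative (linfty X) (linfty_norm X) \<sigma>
           (\<lambda>g. SUP x\<in>A0w X f. g x) f (C_pl X) \<and>
         has_hadamard_dir_derivative (linfty X) (linfty_norm X) \<iota>
           (\<lambda>g. INF x\<in>B0w X f. g x) f (C_pl X) \<and>
         has_hadamard_dir_derivative (linfty X) (linfty_norm X) \<alpha>
           (\<lambda>g. (SUP x\<in>A0w X f. g x) - (INF x\<in>B0w X f. g x)) f (C_pl X) \<and>
         (f \<in> C_pl X - {0} \<longrightarrow>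
           has_hadamard_dir_derivative (linfty X) (linfty_norm X) \<delta>
             (\<lambda>g. SUP x\<in>M_plus X (\<lambda>x. \<bar>f x\<bar>). g x * sgn (f x)) f (C_pl X) \<and>
           has_hadamard_dir_derivative (linfty X) (linfty_norm X) \<sigma>
             (\<lambda>g. SUP x\<in>M_plus X f. g x) f (C_pl X) \<and>
           has_hadamard_dir_derivative (linfty X) (linfty_norm X) \<iota>
             (\<lambda>g. INF x\<in>M_minus X f. g x) f (C_pl X) \<and>
           has_hadamard_dir_derivative (linfty X) (linfty_norm X) \<alpha>
             (\<lambda>g. (SUP x\<in>M_plus X f. g x) - (INF x\<in>M_minus X f. g x)) f (C_pl X))"
proof -
  have X: "X \<noteq> {}" "compactin weak_topology X" by fact+
  note cong = has_hadamard_dir_derivative_cong[OF subspace_linfty]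
  have sup: "has_hadamard_dir_derivative (linfty X) (linfty_norm X) \<sigma>
      (\<lambda>g. SUP x\<in>A0w X f. g x) f (C_pl X)"
    by (rule cong[OF _ _ hadamard_derivative_SUP_A0w[OF X ext_continuous f, of 1]]) (simp_all add: \<sigma>)
  have inf: "has_hadamard_dir_derivative (linfty X) (linfty_norm X) \<iota>
      (\<lambda>g. INF x\<in>B0w X f. g x) f (C_pl X)"
    by (rule cong[OF _ _ hadamard_derivative_INF_B0w[OF X ext_continuous f]]) (simp_all add: \<iota>)
  have amp: "has_hadamard_dir_derivative (linfty X) (linfty_norm X) \<alpha>
      (\<lambda>g. (SUP x\<in>A0w X f. g x) - (INF x\<in>B0w X f. g x)) f (C_pl X)"
    by (rule cong[OF _ _ has_hadamard_dir_derivative_diff[OF sup inf]]) (simp_all add: \<sigma> \<iota> \<alpha>)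
  have norm: "has_hadamard_dir_derivative (linfty X) (linfty_norm X) \<delta>
      (\<lambda>g. SUP x\<in>M_plus X (\<lambda>x. \<bar>f x\<bar>). g x * sgn (f x)) f (C_pl X)" if "f \<in> C_pl X" "f \<noteq> 0"
    by (rule cong[OF _ _ hadamard_derivative_linfty_norm[OF X ext_continuous that]]) (simp_all add: \<delta>)
  \<comment> \<open>For \<open>f\<close> in \<open>C_pl X\<close> the sets of weak limits are the
    sets of extremal points, so the derivatives of \<open>\<sigma>\<close>, \<open>\<iota>\<close>
    and \<open>\<alpha>\<close> take their second form by rewriting.\<close>
  show ?thesis
    using sup inf amp norm
    by (cases "f \<in> C_pl X")
      (simp_all add: A0w_eq_M_plus[OF ext_continuous] B0w_eq_M_minus[OF ext_continuous])
qed

end
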